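(* For the generic $f\in\mathcal{C}^2$ the following holds: whenever $p,q\in\mathbb{R}^2\setminus\operatorname{Ran}(f)$ and $\operatorname{Ran}(f)$ separates $p$ and $q$, then for every continuum $C\subseteq\mathbb{R}^2$ with $p,q\in C$ the intersection $C\cap\operatorname{Ran}(f)$ has cardinality continuum.
   Context: $\mathcal{C}^2$ is the space of all continuous maps $f\colon[0,1]\to\mathbb{R}^2$ with the supremum metric (a complete metric space), and $\operatorname{Ran}(f)=f([0,1])$. "For the generic $f\in\mathcal{C}^2$, property $\mathcal P$ holds" means that $\{f\in\mathcal{C}^2: f\text{ has }\mathcal P\}$ is co-meager (its complement is a countable union of nowhere dense sets). For $A\subseteq\mathbb{R}^2$ and $p,q\in\mathbb{R}^2\setminus A$, $A$ separates $p$ and $q$ if $p$ and $q$ belong to different connected components of $\mathbb{R}^2\setminus A$. A continuum is a compact connected metric space. *)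

theory Defs
  imports "HOL-Analysis.Analysis"
begin

definition nowhere_dense_in :: "'a topology \<Rightarrow> 'a set \<Rightarrow> bool" where
  "nowhere_dense_in X S \<longleftrightarrow> S \<subseteq> topspace X \<and> X interior_of (X closure_of S) = {}"

definition meager_in :: "'a topology \<Rightarrow> 'a set \<Rightarrow> bool" where
  "meager_in X S \<longleftrightarrow>
     (\<exists>N :: nat \<Rightarrow> 'a set. (\<forall>n. nowhere_dense_in X (N n)) \<and> S = (\<Union>n. N n))"

definition comeager_in :: "'a topology \<Rightarrow> 'a set \<Rightarrow> bool" where
  "comeager_in X S \<longleftrightarrow> S \<subseteq> topspace X \<and> meager_in X (topspace X - S)"

text \<open>
  Elements of the library space \<open>cfunspace\<close> are extensional, i.e. undefined outside
  \<open>[0,1]\<close>, so each continuous map on \<open>[0,1]\<close> has exactly one representative; the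
  boundedness that \<open>cfunspace\<close> requires is automatic by compactness, and its metric is
  the supremum metric.
\<close>
definition C2_space :: "(real \<Rightarrow> real ^ 2) metric" where
  "C2_space = cfunspace (top_of_set {0..1}) euclidean_metric"

definition Ran :: "(real \<Rightarrow> 'a) \<Rightarrow> 'a set" where
  "Ran f = f ` {0..1}"

definition generic_C2 :: "((real \<Rightarrow> real ^ 2) \<Rightarrow> bool) \<Rightarrow> bool" where
  "generic_C2 P \<longleftrightarrow> comeager_in (mtopology_of C2_space) {f \<in> mspace C2_space. P f}"

definition separates :: "'a::topological_space set \<Rightarrow> 'a \<Rightarrow> 'a \<Rightarrow> bool" where
  "separates A p q \<longleftrightarrow>
     (\<exists>U \<in> components (- A). \<exists>V \<in> components (- A). p \<in> U \<and> q \<in> V \<and> U \<noteq> V)"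

text \<open>Nonemptiness is part of the notion; it is implied wherever the set contains a given point.\<close>
definition continuum :: "'a::metric_space set \<Rightarrow> bool" where
  "continuum C \<longleftrightarrow> C \<noteq> {} \<and> compact C \<and> connected C"

lemma mem_C2_space_iff:
  "f \<in> mspace C2_space \<longleftrightarrow> continuous_on {0..1} f \<and> f \<in> extensional {0..1}"
proof -
  have "compactin (top_of_set {0..1::real}) (topspace (top_of_set {0..1}))"
    by (simp add: compactin_subtopology)
  then show ?thesis
    unfolding C2_space_def by (subst compactin_mspace_cfunspace) auto
qed

lemma mdist_C2_space:
  assumes "f \<in> mspace C2_space" "g \<in> mspace C2_space"
  shows "mdist C2_space f g = (SUP x\<in>{0..1}. dist (f x) (g x))"
proof -
  have M: "Metric_space (UNIV :: (real ^ 2) set) dist"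
    by (rule Met_TC.Metric_space_axioms)
  show ?thesis
    using assms
    by (simp add: C2_space_def mdist_cfunspace_eq_mdist_funspace Metric_space.fdist_def [OF M]
        Metric_space.fspace_def [OF M] image_subset_iff)
qed

end

theory Submission
  imports Defs
begin

text \<open>
  Call a compact set a cut of \<open>C\<close> if it separates two points of \<open>C\<close>. The point is that for the
  generic \<open>f\<close>, whenever \<open>f[a,b]\<close> cuts a connected set \<open>C\<close>, there are two subintervals of \<open>[a,b]\<close>
  whose images are disjoint and again cut \<open>C\<close>. Iterating this gives a Cantor scheme of compact
  sets \<open>C \<inter> f(I)\<close>, all nonempty because \<open>C\<close> is connected, so \<open>C\<close> meets the range of \<open>f\<close> in
  continuum many points.

  To see that the splitting property is generic, start from an arbitrary \<open>f0\<close> and add to it a small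
  fast oscillation that, in every short time period, draws two concentric \<open>#\<close> signs of different
  sizes around the current position of \<open>f0\<close>. Let \<open>f\<close> be close to the result. Up to points very close
  to the curve, \<open>f[a,b]\<close> separates no more than \<open>f0[a,b]\<close> does, so if \<open>f[a,b]\<close> separates \<open>p, q \<in> C\<close>
  then \<open>C\<close> meets \<open>f0[a,b]\<close> in some point \<open>x\<close>. The strokes of a \<open>#\<close> sign cross, and they keep
  crossing after a small perturbation; hence each of the two signs that \<open>f\<close> draws around \<open>x\<close>
  separates \<open>x\<close> from the distant point \<open>p\<close>, and both points lie in \<open>C\<close>.
\<close>

section \<open>Separation in the plane\<close>

definition cuts :: "'a::topological_space set \<Rightarrow> 'a set \<Rightarrow> bool" where
  "cuts A C \<longleftrightarrow> (\<exists>p\<in>C. \<exists>q\<in>C. separates A p q)"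

lemma separates_iff:
  "separates A p q \<longleftrightarrow> p \<notin> A \<and> q \<notin> A \<and> \<not> connected_component (- A) p q"
proof
  assume "separates A p q"
  then obtain U V where "U \<in> components (- A)" "V \<in> components (- A)" "p \<in> U" "q \<in> V" "U \<noteq> V"
    unfolding separates_def by blast
  then have "p \<in> - A" "q \<in> - A" and
    "U = connected_component_set (- A) p" "V = connected_component_set (- A) q"
    by (metis in_components_subset subsetD components_iff connected_component_eq)+
  then show "p \<notin> A \<and> q \<notin> A \<and> \<not> connected_component (- A) p q"
    using \<open>U \<noteq> V\<close> by (metis ComplD connected_component_eq mem_Collect_eq)
next
  assume R: "p \<notin> A \<and> q \<notin> A \<and> \<not> connected_component (- A) p q"
  then have "connected_component_set (- A) p \<noteq> connected_component_set (- A) q"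
    by (metis ComplI connected_component_refl mem_Collect_eq)
  with R show "separates A p q"
    unfolding separates_def
    by (metis ComplI componentsI connected_component_refl mem_Collect_eq)
qed

lemma separates_meets_connected:
  assumes "separates A p q" "connected C" "p \<in> C" "q \<in> C"
  shows "C \<inter> A \<noteq> {}"
  using assms unfolding separates_iff connected_component_def by blast

text \<open>
  In the application \<open>\<Omega>\<close> is the complement of a curve: a perturbed curve that stays outside of
  \<open>L\<close> separates no points of \<open>K\<close> that the original one does not separate.
\<close>
lemma components_compactly_stable:
  fixes \<Omega> K :: "'a::euclidean_space set"
  assumes "open \<Omega>" "compact K" "K \<subseteq> \<Omega>"
  obtains L where "compact L" "L \<subseteq> \<Omega>"
    "\<And>p q. \<lbrakk>p \<in> K; q \<in> K; connected_component \<Omega> p q\<rbrakk> \<Longrightarrow> connected_component L p q"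
proof -
  have "\<exists>r>0. cball z r \<subseteq> \<Omega>" if "z \<in> K" for z
    using assms that open_contains_cball by blast
  then obtain r where r: "\<And>z. z \<in> K \<Longrightarrow> r z > 0 \<and> cball z (r z) \<subseteq> \<Omega>"
    by metis
  have "K \<subseteq> (\<Union>z\<in>K. ball z (r z))"
    using r by force
  then obtain F where F: "F \<subseteq> K" "finite F" "K \<subseteq> (\<Union>z\<in>F. ball z (r z))"
    using compactE_image[OF \<open>compact K\<close>, of K "\<lambda>z. ball z (r z)"] open_ball by metis
  have "\<exists>S. compact S \<and> S \<subseteq> \<Omega> \<and> (connected_component \<Omega> z w \<longrightarrow> connected_component S z w)" for z w
  proof (cases "connected_component \<Omega> z w")
    case True
    then obtain g where "path g" "path_image g \<subseteq> \<Omega>" "pathstart g = z" "pathfinish g = w"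
      unfolding open_path_connected_component[OF \<open>open \<Omega>\<close>, symmetric] path_component_def
      by auto
    then show ?thesis
      unfolding connected_component_def
      by (intro exI[of _ "path_image g"])
        (use compact_path_image connected_path_image pathfinish_in_path_image
          pathstart_in_path_image in blast)
  qed auto
  then obtain S where S: "\<And>z w. compact (S z w) \<and> S z w \<subseteq> \<Omega>"
    "\<And>z w. connected_component \<Omega> z w \<Longrightarrow> connected_component (S z w) z w"
    by metis
  \<comment> \<open>Within \<open>L\<close>, a point of \<open>K\<close> reaches the centre of a
    covering ball inside that ball, and any two centres in one component of \<open>\<Omega>\<close>
    are joined by the path image \<open>S z w\<close>.\<close>
  define L where "L = (\<Union>z\<in>F. cball z (r z)) \<union> (\<Union>z\<in>F. \<Union>w\<in>F. S z w)"
  show thesis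
  proof
    show "compact L"
      unfolding L_def using F(2) S(1) by (intro compact_Un compact_UN) auto
    show "L \<subseteq> \<Omega>"
      unfolding L_def using F(1) r S(1) by blast
    fix p q assume pq: "p \<in> K" "q \<in> K" "connected_component \<Omega> p q"
    have near: "\<exists>z\<in>F. connected_component L p z \<and> connected_component \<Omega> p z" if "p \<in> K" for p
    proof -
      obtain z where z: "z \<in> F" "p \<in> ball z (r z)"
        using F(3) \<open>p \<in> K\<close> by blast
      moreover from z(1) have "r z > 0"
        using F(1) r by blast
      ultimately have z: "z \<in> F" "p \<in> cball z (r z)" "z \<in> cball z (r z)"
        by auto
      have "cball z (r z) \<subseteq> L" "cball z (r z) \<subseteq> \<Omega>"
        unfolding L_def using z F(1) r by blast+
      then show ?thesis
        using z connected_cball unfolding connected_component_def by blast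
    qed
    obtain z w where zw: "z \<in> F" "connected_component L p z" "connected_component \<Omega> p z"
      "w \<in> F" "connected_component L q w" "connected_component \<Omega> q w"
      using near pq by meson
    then have "connected_component \<Omega> z w"
      using pq(3) by (meson connected_component_sym connected_component_trans)
    then have "connected_component (S z w) z w"
      using S(2) by blast
    then have "connected_component L z w"
      by (rule connected_component_of_subset) (use zw in \<open>auto simp: L_def\<close>)
    then show "connected_component L p q"
      using zw by (meson connected_component_sym connected_component_trans)
  qed
qed

text \<open>This reduces to the Fashoda meet theorem. The curves may overshoot two opposite sides of
  the rectangle each, since clamping one coordinate of each curve brings them into it.\<close>

lemma crossing_curves_meet:
  fixes \<gamma>1 \<gamma>2 \<sigma>1 \<sigma>2 :: "real \<Rightarrow> real"
  assumes cont: "continuous_on {s0..s1} \<gamma>1" "continuous_on {s0..s1} \<gamma>2"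
      "continuous_on {u0..u1} \<sigma>1" "continuous_on {u0..u1} \<sigma>2"
    and le: "s0 \<le> s1" "u0 \<le> u1"
    and \<gamma>: "\<gamma>1 s0 \<le> l" "\<gamma>1 s1 \<ge> r" "\<And>s. s \<in> {s0..s1} \<Longrightarrow> \<bar>\<gamma>2 s\<bar> < h"
    and \<sigma>: "\<And>u. u \<in> {u0..u1} \<Longrightarrow> l < \<sigma>1 u \<and> \<sigma>1 u < r" "\<sigma>2 u0 \<le> -h" "\<sigma>2 u1 \<ge> h"
  shows "\<exists>s\<in>{s0..s1}. \<exists>u\<in>{u0..u1}. \<gamma>1 s = \<sigma>1 u \<and> \<gamma>2 s = \<sigma>2 u"
proof -
  define S where "S t = s0 + t * (s1 - s0)" for t
  define U where "U t = u0 + t * (u1 - u0)" for t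
  have S: "S t \<in> {s0..s1}" and U: "U t \<in> {u0..u1}" if "t \<in> {0..1}" for t
    using that le mult_left_le_one_le[of "s1 - s0" t] mult_left_le_one_le[of "u1 - u0" t]
    by (auto simp: S_def U_def)
  have cS: "continuous_on {0..1} S" and cU: "continuous_on {0..1} U"
    unfolding S_def U_def by (intro continuous_intros)+
  have c: "continuous_on {0..1} (\<lambda>t. \<gamma>1 (S t))" "continuous_on {0..1} (\<lambda>t. \<gamma>2 (S t))"
    "continuous_on {0..1} (\<lambda>t. \<sigma>1 (U t))" "continuous_on {0..1} (\<lambda>t. \<sigma>2 (U t))"
    using S U by (auto intro!: continuous_on_compose2[OF _ cS] continuous_on_compose2[OF _ cU] cont)
  have h: "h > 0" using \<gamma>(3)[of s0] le by auto
  have lr: "l < r" using \<sigma>(1)[of u0] le by auto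
  define F :: "real \<Rightarrow> real^2" where "F t = vector [max l (min r (\<gamma>1 (S t))), \<gamma>2 (S t)]" for t
  define G :: "real \<Rightarrow> real^2" where "G t = vector [\<sigma>1 (U t), max (-h) (min h (\<sigma>2 (U t)))]" for t
  have vec: "path (\<lambda>t. vector [a t, b t] :: real^2)"
    if "continuous_on {0..1} a" "continuous_on {0..1} b" for a b :: "real \<Rightarrow> real"
  proof -
    have "continuous_on {0..1} (\<lambda>t. a t *\<^sub>R axis 1 1 + b t *\<^sub>R axis 2 1 :: real^2)"
      using that by (intro continuous_intros)
    also have "(\<lambda>t. a t *\<^sub>R axis 1 1 + b t *\<^sub>R axis 2 1 :: real^2) = (\<lambda>t. vector [a t, b t])"
      by (auto simp: vec_eq_iff forall_2 axis_def)
    finally show ?thesis by (simp add: path_def)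
  qed
  have "path F" "path G"
    unfolding F_def G_def by (intro vec continuous_intros c)+
  moreover have "path_image F \<subseteq> cbox (vector [l, -h]) (vector [r, h])"
  proof -
    have "\<bar>\<gamma>2 (S t)\<bar> < h" if "t \<in> {0..1}" for t using \<gamma>(3)[OF S[OF that]] .
    then show ?thesis using lr by (fastforce simp: path_image_def F_def mem_box_cart forall_2)
  qed
  moreover have "path_image G \<subseteq> cbox (vector [l, -h]) (vector [r, h])"
  proof -
    have "l < \<sigma>1 (U t) \<and> \<sigma>1 (U t) < r" if "t \<in> {0..1}" for t using \<sigma>(1)[OF U[OF that]] .
    then show ?thesis using h by (fastforce simp: path_image_def G_def mem_box_cart forall_2)
  qed
  moreover have "pathstart F $ 1 = (vector [l, -h] :: real^2) $ 1" "pathfinish F $ 1 = (vector [r, h] :: real^2) $ 1"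
    "pathstart G $ 2 = (vector [l, -h] :: real^2) $ 2" "pathfinish G $ 2 = (vector [r, h] :: real^2) $ 2"
    using \<gamma>(1,2) \<sigma>(2,3) lr h by (auto simp: pathstart_def pathfinish_def F_def G_def S_def U_def)
  ultimately obtain z where "z \<in> path_image F" "z \<in> path_image G"
    by (rule fashoda)
  then obtain t t' where t: "t \<in> {0..1}" "t' \<in> {0..1}" "F t = G t'"
    by (auto simp: path_image_def)
  then have e: "max l (min r (\<gamma>1 (S t))) = \<sigma>1 (U t')" "\<gamma>2 (S t) = max (-h) (min h (\<sigma>2 (U t')))"
    by (auto simp: F_def G_def vec_eq_iff forall_2)
  \<comment> \<open>The strict bounds show that no clamping took place at the meeting point:
    \<open>\<sigma>1\<close> never takes the values \<open>l\<close> and \<open>r\<close>, and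
    \<open>\<gamma>2\<close> never takes the values \<open>-h\<close> and \<open>h\<close>.\<close>
  have "\<gamma>1 (S t) = \<sigma>1 (U t')" "\<gamma>2 (S t) = \<sigma>2 (U t')"
    using e \<sigma>(1)[OF U[OF t(2)]] \<gamma>(3)[OF S[OF t(1)]] by (auto simp: max_def min_def split: if_splits)
  then show ?thesis using S[OF t(1)] U[OF t(2)] by blast
qed

text \<open>In a T1 space a point is determined by the basic open sets that contain it, so a
  countable basis embeds the space into the subsets of the naturals.\<close>

lemma second_countable_lepoll_real:
  "(S :: 'a::{second_countable_topology, t1_space} set) \<lesssim> (UNIV :: real set)"
proof -
  obtain B :: "'a set set" where B: "countable B" "topological_basis B"
    using ex_countable_basis by auto
  define \<phi> where "\<phi> z = {n. z \<in> from_nat_into B n}" for z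
  have "inj \<phi>"
  proof (rule injI, rule ccontr)
    fix z w assume eq: "\<phi> z = \<phi> w" "z \<noteq> w"
    then obtain U where "open U" "z \<in> U" "w \<notin> U"
      by (meson t1_space)
    then obtain b where "b \<in> B" "z \<in> b" "w \<notin> b"
      using topological_basisE[OF B(2)] by (metis subsetD)
    obtain n where "from_nat_into B n = b"
      using from_nat_into_surj[OF B(1) \<open>b \<in> B\<close>] by blast
    then show False
      using eq \<open>z \<in> b\<close> \<open>w \<notin> b\<close> unfolding \<phi>_def by blast
  qed
  then have "S \<lesssim> (UNIV :: nat set set)"
    unfolding lepoll_def by (metis inj_on_subset subset_UNIV)
  then show ?thesis
    using lepoll_trans2 nat_sets_eqpoll_reals by blast
qed

section \<open>Curves that trace a hash sign\<close>

text \<open>The coefficient of edge \<open>k\<close> grows from 0 to 1 during the time from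
  \<open>k\<close> to \<open>k + 1\<close> and is constant otherwise. As a sum of continuous terms
  the path needs no gluing of segments.\<close>

definition polyline :: "(nat \<Rightarrow> 'a::real_normed_vector) \<Rightarrow> nat \<Rightarrow> real \<Rightarrow> 'a" where
  "polyline v m s = v 0 + (\<Sum>k<m. max 0 (min 1 (s - real k)) *\<^sub>R (v (Suc k) - v k))"

lemma continuous_on_polyline: "continuous_on A (polyline v m)"
  unfolding polyline_def by (intro continuous_intros)

text \<open>The edges before \<open>k\<close> have coefficient 1 and telescope to
  \<open>v k - v 0\<close>; the edges after \<open>k\<close> have coefficient 0.\<close>

lemma polyline_segment:
  assumes "k < m" "u \<in> {0..1}"
  shows "polyline v m (real k + u) = (1 - u) *\<^sub>R v k + u *\<^sub>R v (Suc k)"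
proof -
  let ?t = "\<lambda>j. max 0 (min 1 (real k + u - real j)) *\<^sub>R (v (Suc j) - v j)"
  have "{..<m} = {..<k} \<union> {k} \<union> {Suc k..<m}"
    using assms by auto
  then have "sum ?t {..<m} = sum ?t {..<k} + ?t k + sum ?t {Suc k..<m}"
    by (simp only: \<open>{..<m} = _\<close>) (subst sum.union_disjoint; fastforce)+
  also have "sum ?t {..<k} = (\<Sum>j<k. v (Suc j) - v j)"
    using assms by (intro sum.cong) (auto simp: max_def min_def)
  also have "\<dots> = v k - v 0"
    by (rule sum_lessThan_telescope)
  also have "sum ?t {Suc k..<m} = 0"
    using assms by (intro sum.neutral) (auto simp: max_def min_def)
  also have "?t k = u *\<^sub>R (v (Suc k) - v k)"
    using assms by (auto simp: max_def min_def)
  finally show ?thesis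
    unfolding polyline_def by (simp add: algebra_simps)
qed

lemma segment_index:
  fixes s :: real
  assumes "0 \<le> s" "s \<le> real m" "0 < m"
  obtains k u where "k < m" "u \<in> {0..1}" "s = real k + u"
proof (cases "s = real m")
  case True
  \<comment> \<open>The final time has no segment starting at it, so it is counted as the end of the
    last one.\<close>
  show thesis by (rule that[of "m - 1" 1]) (use assms True in \<open>auto simp: of_nat_diff\<close>)
next
  case False
  have "real (nat \<lfloor>s\<rfloor>) \<le> s" "s < real (nat \<lfloor>s\<rfloor>) + 1"
    using assms by linarith+
  then show thesis
    using assms False by (intro that[of "nat \<lfloor>s\<rfloor>" "s - real (nat \<lfloor>s\<rfloor>)"]; simp; linarith)
qed

lemma norm_polyline_le:
  assumes "\<And>k. norm (v k) \<le> r" "0 \<le> s" "s \<le> real m" "0 < m"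
  shows "norm (polyline v m s) \<le> r"
proof -
  obtain k u where k: "k < m" "u \<in> {0..1}" "s = real k + u"
    using segment_index assms(2-) by blast
  have "(1 - u) *\<^sub>R v k + u *\<^sub>R v (Suc k) \<in> cball 0 r"
    using k assms(1) by (intro convexD) auto
  then show ?thesis
    using polyline_segment[OF k(1,2), of v] k(3) by simp
qed

text \<open>
  The segments 0, 2, 4, 6 of this polygon are the right, top, left and bottom stroke of a \<open>#\<close> sign;
  the segments in between join the loose ends while staying away from the centre.
\<close>
definition hash_vertex :: "nat \<Rightarrow> real ^ 2" where
  "hash_vertex k = vector [[1, 1, 3, -3, -1, -1, -3, 3] ! k, [-3, 3, 1, 1, 3, -3, -1, -1] ! k]"

text \<open>In units of \<open>c\<close>, the tolerance 1/5 keeps each stroke strictly between the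
  centre and the parallel side of the square of half-width 2, lets its ends still reach 5/2, and
  keeps the whole curve away from the centre.\<close>

definition traces_hash :: "(real \<Rightarrow> real ^ 2) \<Rightarrow> real ^ 2 \<Rightarrow> real \<Rightarrow> bool" where
  "traces_hash h x c \<longleftrightarrow> 0 < c \<and> continuous_on {0..7} h \<and>
     (\<forall>k<7. \<forall>u\<in>{0..1}. dist (h (real k + u))
        (x + c *\<^sub>R ((1 - u) *\<^sub>R hash_vertex k + u *\<^sub>R hash_vertex (Suc k))) \<le> c / 5)"

lemma traces_hash_coordinate:
  assumes "traces_hash h x c" "k < 7" "u \<in> {0..1}"
  shows "\<bar>(h (real k + u) - x) $ i / c - ((1 - u) * hash_vertex k $ i + u * hash_vertex (Suc k) $ i)\<bar> \<le> 1 / 5"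
proof -
  let ?w = "(1 - u) *\<^sub>R hash_vertex k + u *\<^sub>R hash_vertex (Suc k)"
  have c: "c > 0" and "norm (h (real k + u) - (x + c *\<^sub>R ?w)) \<le> c / 5"
    using assms unfolding traces_hash_def by (auto simp: dist_norm)
  then have "\<bar>(h (real k + u) - (x + c *\<^sub>R ?w)) $ i\<bar> \<le> c / 5"
    using component_le_norm_cart order_trans by blast
  then have "\<bar>(h (real k + u) - (x + c *\<^sub>R ?w)) $ i / c\<bar> \<le> 1 / 5"
    using c by (simp add: abs_divide field_simps)
  moreover have "(h (real k + u) - (x + c *\<^sub>R ?w)) $ i / c = (h (real k + u) - x) $ i / c - ?w $ i"
    using c by (simp add: field_simps)
  ultimately show ?thesis
    by (simp only: vector_add_component vector_scaleR_component real_scaleR_def)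
qed

text \<open>In units of \<open>c\<close> the exact polygon has maximum norm between 1 and 3 at every
  point, and the error is at most 1/5. This keeps the curve off its centre, off far points, and off
  a second sign of a different size.\<close>

lemma traces_hash_location:
  assumes "traces_hash h x c" "s \<in> {0..7}"
  shows "4 / 5 \<le> \<bar>(h s - x) $ 1 / c\<bar> \<or> 4 / 5 \<le> \<bar>(h s - x) $ 2 / c\<bar>"
    and "\<bar>(h s - x) $ i / c\<bar> \<le> 16 / 5"
proof -
  obtain k u where k: "k < 7" "u \<in> {0..1}" "s = real k + u"
    using segment_index[of s 7] assms(2) by auto
  define a where "a = (h s - x) $ 1 / c"
  define b where "b = (h s - x) $ 2 / c"
  have ab: "\<bar>a - ((1 - u) * hash_vertex k $ 1 + u * hash_vertex (Suc k) $ 1)\<bar> \<le> 1 / 5"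
    "\<bar>b - ((1 - u) * hash_vertex k $ 2 + u * hash_vertex (Suc k) $ 2)\<bar> \<le> 1 / 5"
    using traces_hash_coordinate[OF assms(1) k(1,2)] unfolding a_def b_def k(3) by auto
  have u: "0 \<le> u" "u \<le> 1"
    using k(2) by auto
  have "k \<in> {0, 1, 2, 3, 4, 5, 6}"
    using k(1) by auto
  \<comment> \<open>On each edge one fixed coordinate has absolute value at least 1: the second on
    edges 2 and 6, the first on all others.\<close>
  then have *: "(4 / 5 \<le> \<bar>a\<bar> \<or> 4 / 5 \<le> \<bar>b\<bar>) \<and> \<bar>a\<bar> \<le> 16 / 5 \<and> \<bar>b\<bar> \<le> 16 / 5"
  proof (elim insertE emptyE)
    assume "k = 0"
    then have "(1 - u) * 1 + u * 1 - 1 / 5 \<le> a" "a \<le> (1 - u) * 1 + u * 1 + 1 / 5"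
      "(1 - u) * -3 + u * 3 - 1 / 5 \<le> b" "b \<le> (1 - u) * -3 + u * 3 + 1 / 5"
      using ab unfolding abs_diff_le_iff by (simp_all add: hash_vertex_def)
    then show ?thesis
      using u by - (intro conjI disjI1; simp add: algebra_simps; linarith?)
  next
    assume "k = 1"
    then have "(1 - u) * 1 + u * 3 - 1 / 5 \<le> a" "a \<le> (1 - u) * 1 + u * 3 + 1 / 5"
      "(1 - u) * 3 + u * 1 - 1 / 5 \<le> b" "b \<le> (1 - u) * 3 + u * 1 + 1 / 5"
      using ab unfolding abs_diff_le_iff by (simp_all add: hash_vertex_def)
    then show ?thesis
      using u by - (intro conjI disjI1; simp add: algebra_simps; linarith?)
  next
    assume "k = 2"
    then have "(1 - u) * 3 + u * -3 - 1 / 5 \<le> a" "a \<le> (1 - u) * 3 + u * -3 + 1 / 5"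
      "(1 - u) * 1 + u * 1 - 1 / 5 \<le> b" "b \<le> (1 - u) * 1 + u * 1 + 1 / 5"
      using ab unfolding abs_diff_le_iff by (simp_all add: hash_vertex_def)
    then show ?thesis
      using u by - (intro conjI disjI2; simp add: algebra_simps; linarith?)
  next
    assume "k = 3"
    then have "(1 - u) * -3 + u * -1 - 1 / 5 \<le> a" "a \<le> (1 - u) * -3 + u * -1 + 1 / 5"
      "(1 - u) * 1 + u * 3 - 1 / 5 \<le> b" "b \<le> (1 - u) * 1 + u * 3 + 1 / 5"
      using ab unfolding abs_diff_le_iff by (simp_all add: hash_vertex_def)
    then show ?thesis
      using u by - (intro conjI disjI1; simp add: algebra_simps; linarith?)
  next
    assume "k = 4"
    then have "(1 - u) * -1 + u * -1 - 1 / 5 \<le> a" "a \<le> (1 - u) * -1 + u * -1 + 1 / 5"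
      "(1 - u) * 3 + u * -3 - 1 / 5 \<le> b" "b \<le> (1 - u) * 3 + u * -3 + 1 / 5"
      using ab unfolding abs_diff_le_iff by (simp_all add: hash_vertex_def)
    then show ?thesis
      using u by - (intro conjI disjI1; simp add: algebra_simps; linarith?)
  next
    assume "k = 5"
    then have "(1 - u) * -1 + u * -3 - 1 / 5 \<le> a" "a \<le> (1 - u) * -1 + u * -3 + 1 / 5"
      "(1 - u) * -3 + u * -1 - 1 / 5 \<le> b" "b \<le> (1 - u) * -3 + u * -1 + 1 / 5"
      using ab unfolding abs_diff_le_iff by (simp_all add: hash_vertex_def)
    then show ?thesis
      using u by - (intro conjI disjI1; simp add: algebra_simps; linarith?)
  next
    assume "k = 6"
    then have "(1 - u) * -3 + u * 3 - 1 / 5 \<le> a" "a \<le> (1 - u) * -3 + u * 3 + 1 / 5"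
      "(1 - u) * -1 + u * -1 - 1 / 5 \<le> b" "b \<le> (1 - u) * -1 + u * -1 + 1 / 5"
      using ab unfolding abs_diff_le_iff by (simp_all add: hash_vertex_def)
    then show ?thesis
      using u by - (intro conjI disjI2; simp add: algebra_simps; linarith?)
  qed
  then show "4 / 5 \<le> \<bar>(h s - x) $ 1 / c\<bar> \<or> 4 / 5 \<le> \<bar>(h s - x) $ 2 / c\<bar>"
    unfolding a_def b_def by blast
  show "\<bar>(h s - x) $ i / c\<bar> \<le> 16 / 5"
    using * exhaust_2[of i] unfolding a_def b_def by auto
qed

text \<open>The least time at which \<open>g\<close> takes the value \<open>r\<close> works: by the
  intermediate value theorem, a larger value before it would force a still earlier such
  time.\<close>

lemma exit_time:
  fixes g :: "real \<Rightarrow> real"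
  assumes "continuous_on {0..1} g" "g 0 \<le> r" "r \<le> g 1"
  obtains t where "t \<in> {0..1}" "g t = r" "\<And>s. s \<in> {0..t} \<Longrightarrow> g s \<le> r"
proof -
  let ?T = "{s \<in> {0..1}. g s = r}"
  have "closed ?T"
    using continuous_closed_preimage_constant[OF assms(1)] by simp
  then have "compact ({0..1} \<inter> ?T)"
    by (rule compact_Int_closed[OF compact_Icc])
  then have "compact ?T"
    by (simp add: Int_def conj_commute conj_left_commute)
  moreover have "?T \<noteq> {}"
    using IVT'[of g 0 r 1] assms by auto
  ultimately obtain t where t: "t \<in> ?T" "\<And>s. s \<in> ?T \<Longrightarrow> t \<le> s"
    using compact_attains_inf[of ?T] by blast
  have "g s \<le> r" if s: "s \<in> {0..t}" for s
  proof (rule ccontr)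
    assume "\<not> g s \<le> r"
    moreover have "continuous_on {0..s} g"
      using assms(1) by (rule continuous_on_subset) (use s t(1) in auto)
    ultimately obtain s' where "0 \<le> s'" "s' \<le> s" "g s' = r"
      using IVT'[of g 0 r s] assms(2) s by auto
    then have "s' = t"
      using t(2)[of s'] s t(1) by auto
    then show False
      using \<open>s' \<le> s\<close> s \<open>\<not> g s \<le> r\<close> \<open>g s' = r\<close> by auto
  qed
  then show thesis
    using that t(1) by blast
qed

text \<open>The factor 7 makes one coordinate of \<open>z - x\<close> at least 7/2 in units of
  \<open>c\<close>. This exceeds 16/5, so \<open>z\<close> is off the curve, and it exceeds 2, so
  any path from \<open>x\<close> to \<open>z\<close> leaves the square of half-width 2.\<close>

lemma traces_hash_separates:
  assumes h: "traces_hash h x c" and far: "7 * c \<le> dist x z"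
  shows "separates (h ` {0..7}) x z"
  unfolding separates_iff
proof (intro conjI notI)
  have c: "c > 0" and conth: "continuous_on {0..7} h"
    using h unfolding traces_hash_def by auto
  define a where "a s = (h s - x) $ 1 / c" for s
  define b where "b s = (h s - x) $ 2 / c" for s
  have cont: "continuous_on S a" "continuous_on S b" if "S \<subseteq> {0..7}" for S
    unfolding a_def b_def using c conth that by (auto intro!: continuous_intros elim: continuous_on_subset)
  have coord: "\<bar>a (real k + u) - ((1 - u) * hash_vertex k $ 1 + u * hash_vertex (Suc k) $ 1)\<bar> \<le> 1 / 5"
    "\<bar>b (real k + u) - ((1 - u) * hash_vertex k $ 2 + u * hash_vertex (Suc k) $ 2)\<bar> \<le> 1 / 5"
    if "k < 7" "u \<in> {0..1}" for k u
    using traces_hash_coordinate[OF h that] unfolding a_def b_def by auto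
  have right: "\<bar>a s - 1\<bar> \<le> 1 / 5" if "s \<in> {0..1}" for s
    using coord(1)[of 0 s] that by (simp add: hash_vertex_def)
  have top: "\<bar>b s - 1\<bar> \<le> 1 / 5" if "s \<in> {2..3}" for s
    using coord(2)[of 2 "s - 2"] that by (simp add: hash_vertex_def)
  have left: "\<bar>a s + 1\<bar> \<le> 1 / 5" if "s \<in> {4..5}" for s
    using coord(1)[of 4 "s - 4"] that by (simp add: hash_vertex_def algebra_simps)
  have bottom: "\<bar>b s + 1\<bar> \<le> 1 / 5" if "s \<in> {6..7}" for s
    using coord(2)[of 6 "s - 6"] that by (simp add: hash_vertex_def algebra_simps)
  have ends: "b 0 \<le> - (5/2)" "b 1 \<ge> 5/2" "a 2 \<ge> 5/2" "a 3 \<le> - (5/2)"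
    "b 4 \<ge> 5/2" "b 5 \<le> - (5/2)" "a 6 \<le> - (5/2)" "a 7 \<ge> 5/2"
    using coord(2)[of 0 0] coord(2)[of 0 1] coord(1)[of 2 0] coord(1)[of 2 1]
      coord(2)[of 4 0] coord(2)[of 4 1] coord(1)[of 6 0] coord(1)[of 6 1]
    unfolding abs_diff_le_iff by (simp_all add: hash_vertex_def)
  have "7 \<le> \<bar>(z - x) $ 1 / c\<bar> + \<bar>(z - x) $ 2 / c\<bar>"
  proof -
    have "7 * c \<le> \<bar>(z - x) $ 1\<bar> + \<bar>(z - x) $ 2\<bar>"
      using far norm_le_l1_cart[of "z - x"] by (simp add: dist_norm norm_minus_commute sum_2)
    then show ?thesis using c by (simp add: field_simps)
  qed
  then have zfar: "7/2 \<le> \<bar>(z - x) $ 1 / c\<bar> \<or> 7/2 \<le> \<bar>(z - x) $ 2 / c\<bar>"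
    by linarith
  show False if x: "x \<in> h ` {0..7}"
  proof -
    obtain s where "s \<in> {0..7}" "h s = x" using x by auto
    then show False using traces_hash_location(1)[OF h, of s] by simp
  qed
  show False if z: "z \<in> h ` {0..7}"
  proof -
    obtain s where s: "s \<in> {0..7}" "z = h s" using z by blast
    show False using zfar traces_hash_location(2)[OF h s(1), of 1]
      traces_hash_location(2)[OF h s(1), of 2] unfolding s(2) by linarith
  qed
  show False if conn: "connected_component (- h ` {0..7}) x z"
  proof -
    \<comment> \<open>Components of an open set are path connected, so a common component provides
      an actual path.\<close>
    have "open (- h ` {0..7})"
      using compact_continuous_image[OF conth] by (simp add: compact_imp_closed open_Compl)
    then obtain \<gamma> where \<gamma>: "path \<gamma>" "path_image \<gamma> \<subseteq> - h ` {0..7}" "\<gamma> 0 = x" "\<gamma> 1 = z"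
      using conn unfolding open_path_connected_component[OF \<open>open _\<close>, symmetric]
        path_component_def pathstart_def pathfinish_def by auto
    define g1 where "g1 t = (\<gamma> t - x) $ 1 / c" for t
    define g2 where "g2 t = (\<gamma> t - x) $ 2 / c" for t
    have contg: "continuous_on {0..1} g1" "continuous_on {0..1} g2"
      unfolding g1_def g2_def using c \<gamma>(1) by (auto intro!: continuous_intros simp: path_def)
    have "continuous_on {0..1} (\<lambda>t. max \<bar>g1 t\<bar> \<bar>g2 t\<bar>)"
      by (intro continuous_intros contg)
    then obtain t1 where t1: "t1 \<in> {0..1}" "max \<bar>g1 t1\<bar> \<bar>g2 t1\<bar> = 2"
      "\<And>t. t \<in> {0..t1} \<Longrightarrow> max \<bar>g1 t\<bar> \<bar>g2 t\<bar> \<le> 2"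
    proof (rule exit_time[where r = 2])
      show "max \<bar>g1 0\<bar> \<bar>g2 0\<bar> \<le> 2" by (simp add: g1_def g2_def \<gamma>(3))
      show "2 \<le> max \<bar>g1 1\<bar> \<bar>g2 1\<bar>" using zfar unfolding g1_def g2_def \<gamma>(4) by linarith
    qed blast
    have avoid: False if "t \<in> {0..t1}" "s \<in> {0..7}" "g1 t = a s" "g2 t = b s" for t s
    proof -
      have "\<gamma> t = h s"
        using that(3,4) c by (simp add: g1_def g2_def a_def b_def vec_eq_iff forall_2)
      moreover have "\<gamma> t \<in> path_image \<gamma>"
        using that(1) t1(1) by (auto simp: path_image_def)
      ultimately show False using \<gamma>(2) that(2) by auto
    qed
    have sub: "continuous_on {0..t1} g1" "continuous_on {0..t1} g2"
      using contg t1(1) by (auto elim!: continuous_on_subset)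
    have start: "g1 0 = 0" "g2 0 = 0" by (simp_all add: g1_def g2_def \<gamma>(3))
    have bd: "\<bar>g1 t\<bar> < 5/2" "\<bar>g2 t\<bar> < 5/2" if "t \<in> {0..t1}" for t
      using t1(3)[OF that] by auto
    have "g1 t1 = 2 \<or> g2 t1 = 2 \<or> g1 t1 = -2 \<or> g2 t1 = -2"
      using t1(2) by (auto simp: max_def abs_if split: if_splits)
    \<comment> \<open>The path leaves the square of radius 2 through one of its sides and has to cross the
      stroke parallel to that side.\<close>
    then show False
    proof (elim disjE)
      assume e: "g1 t1 = 2"
      \<comment> \<open>The half-height 5/2 exceeds the bound 2 on the path and is still reached by
        both ends of the stroke.\<close>
      have "\<exists>t\<in>{0..t1}. \<exists>s\<in>{0..1}. g1 t = a s \<and> g2 t = b s"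
      proof (rule crossing_curves_meet[where l = 0 and r = 2 and h = "5/2"])
        show "0 < a s \<and> a s < 2" if "s \<in> {0..1}" for s
          using right[OF that] by linarith
      qed (use t1(1) start bd ends sub e in \<open>auto intro!: continuous_intros cont\<close>)
      then show False using avoid by force
    next
      \<comment> \<open>The other three sides follow after a rotation that turns the exit direction
        into the first positive axis. The strokes are oriented so that each then runs
        upwards.\<close>
      assume e: "g2 t1 = 2"
      have "\<exists>t\<in>{0..t1}. \<exists>s\<in>{2..3}. g2 t = b s \<and> - g1 t = - a s"
      proof (rule crossing_curves_meet[where l = 0 and r = 2 and h = "5/2"])
        show "0 < b s \<and> b s < 2" if "s \<in> {2..3}" for s
          using top[OF that] by linarith
      qed (use t1(1) start bd ends sub e in \<open>auto intro!: continuous_intros cont\<close>)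
      then show False using avoid by force
    next
      assume e: "g1 t1 = -2"
      have "\<exists>t\<in>{0..t1}. \<exists>s\<in>{4..5}. - g1 t = - a s \<and> - g2 t = - b s"
      proof (rule crossing_curves_meet[where l = 0 and r = 2 and h = "5/2"])
        show "0 < - a s \<and> - a s < 2" if "s \<in> {4..5}" for s
          using left[OF that] by linarith
      qed (use t1(1) start bd ends sub e in \<open>auto intro!: continuous_intros cont\<close>)
      then show False using avoid by force
    next
      assume e: "g2 t1 = -2"
      have "\<exists>t\<in>{0..t1}. \<exists>s\<in>{6..7}. - g2 t = - b s \<and> g1 t = a s"
      proof (rule crossing_curves_meet[where l = 0 and r = 2 and h = "5/2"])
        show "0 < - b s \<and> - b s < 2" if "s \<in> {6..7}" for s
          using bottom[OF that] by linarith
      qed (use t1(1) start bd ends sub e in \<open>auto intro!: continuous_intros cont\<close>)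
      then show False using avoid by force
    qed
  qed
qed

section \<open>Density of the splitting property\<close>

text \<open>Rational end points keep the scheme within a countable family of intervals, which is all
  that a comeager set can control.\<close>

definition splits :: "(real \<Rightarrow> real ^ 2) \<Rightarrow> (real ^ 2) set \<Rightarrow> real \<Rightarrow> real \<Rightarrow> bool" where
  "splits f C a b \<longleftrightarrow> (\<exists>c\<in>\<rat>. \<exists>d\<in>\<rat>. \<exists>c'\<in>\<rat>. \<exists>d'\<in>\<rat>.
     a \<le> c \<and> c < d \<and> d \<le> b \<and> a \<le> c' \<and> c' < d' \<and> d' \<le> b \<and>
     f ` {c..d} \<inter> f ` {c'..d'} = {} \<and> cuts (f ` {c..d}) C \<and> cuts (f ` {c'..d'}) C)"

text \<open>As \<open>M\<close> grows, these bounded sets exhaust the complement of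
  \<open>f[a,b]\<close>. On each of them a single size of perturbation is harmless.\<close>

definition clear_of :: "(real \<Rightarrow> real ^ 2) \<Rightarrow> real \<Rightarrow> real \<Rightarrow> real \<Rightarrow> (real ^ 2) set" where
  "clear_of f a b M = {p. norm p \<le> M \<and> (\<forall>t\<in>{a..b}. 1 / M \<le> dist p (f t))}"

text \<open>In units of the larger sign, the smaller one has maximum norm at most 16/25 and the
  larger one at least 4/5. This is where the ratio 5 comes from.\<close>

lemma traces_hash_disjoint:
  assumes "traces_hash h x c" "traces_hash h' x (5 * c)"
  shows "h ` {0..7} \<inter> h' ` {0..7} = {}"
proof (rule ccontr)
  assume "h ` {0..7} \<inter> h' ` {0..7} \<noteq> {}"
  then obtain s s' where s: "s \<in> {0..7}" "s' \<in> {0..7}" "h s = h' s'"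
    by fastforce
  have "\<bar>(h s - x) $ i / (5 * c)\<bar> < 4 / 5" for i
  proof -
    have "\<bar>(h s - x) $ i / (5 * c)\<bar> = \<bar>(h s - x) $ i / c\<bar> / 5"
      by (simp add: abs_divide abs_mult)
    also have "\<dots> \<le> (16 / 5) / 5"
      using traces_hash_location(2)[OF assms(1) s(1), of i] by (rule divide_right_mono) simp
    finally show ?thesis
      by simp
  qed
  then show False
    using traces_hash_location(1)[OF assms(2) s(2)] unfolding s(3)[symmetric] by (meson not_le)
qed

text \<open>Each period of sixteen vertices draws a small sign and then one five times as large.
  Edges 7 and 15 of a period only lead to the next sign.\<close>

definition hash_walk :: "nat \<Rightarrow> real ^ 2" where
  "hash_walk k = (if k mod 16 < 8 then hash_vertex (k mod 16) else 5 *\<^sub>R hash_vertex (k mod 16 - 8))"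

lemma hash_walk_inner: "k < 8 \<Longrightarrow> hash_walk (16 * j + k) = hash_vertex k"
  by (simp add: hash_walk_def)

lemma hash_walk_outer: "k < 8 \<Longrightarrow> hash_walk (16 * j + 8 + k) = 5 *\<^sub>R hash_vertex k"
  by (simp add: hash_walk_def add.assoc)

lemma norm_hash_vertex_le:
  assumes "k < 8" shows "norm (hash_vertex k) \<le> 4"
proof -
  have "k \<in> {0, 1, 2, 3, 4, 5, 6, 7}"
    using assms by auto
  then have "\<bar>hash_vertex k $ 1\<bar> + \<bar>hash_vertex k $ 2\<bar> \<le> 4"
    by (elim insertE emptyE) (simp_all add: hash_vertex_def)
  then show ?thesis
    using norm_le_l1_cart[of "hash_vertex k"] by (simp add: sum_2)
qed

lemma norm_hash_walk_le: "norm (hash_walk k) \<le> 20"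
proof (cases "k mod 16 < 8")
  case True
  then show ?thesis
    using norm_hash_vertex_le[OF True] unfolding hash_walk_def by simp
next
  case False
  have "k mod 16 < 16" by simp
  then have "k mod 16 - 8 < 8" by linarith
  from norm_hash_vertex_le[OF this] False show ?thesis
    unfolding hash_walk_def by simp
qed

text \<open>Edges 0 to 6 of period \<open>j\<close> form the small sign and edges 8 to 14 the large
  one. The large sign tolerates an error of \<open>\<eta>\<close>, so the bound for the small sign
  serves both.\<close>

lemma near_hash_walk_traces_hash:
  assumes "0 < \<eta>" "continuous_on {0..15} F" "16 * j + 16 \<le> m"
    and near: "\<And>s. s \<in> {0..15} \<Longrightarrow> dist (F s) (x + \<eta> *\<^sub>R polyline hash_walk m (16 * real j + s)) \<le> \<eta> / 5"
  shows "traces_hash F x \<eta>" "traces_hash (\<lambda>s. F (8 + s)) x (5 * \<eta>)"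
proof -
  show "traces_hash F x \<eta>"
    unfolding traces_hash_def
  proof (intro conjI allI impI ballI)
    fix k :: nat and u :: real assume k: "k < 7" "u \<in> {0..1}"
    have "polyline hash_walk m (real (16 * j + k) + u)
        = (1 - u) *\<^sub>R hash_walk (16 * j + k) + u *\<^sub>R hash_walk (16 * j + Suc k)"
      using polyline_segment[of "16 * j + k" m u hash_walk] k assms(3) by simp
    also have "\<dots> = (1 - u) *\<^sub>R hash_vertex k + u *\<^sub>R hash_vertex (Suc k)"
      using k(1) by (simp only: hash_walk_inner)
    finally have *: "polyline hash_walk m (16 * real j + (real k + u))
        = (1 - u) *\<^sub>R hash_vertex k + u *\<^sub>R hash_vertex (Suc k)"
      by (simp add: add.assoc)
    have "real k \<le> 6" "0 \<le> u" "u \<le> 1"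
      using k by auto
    then have "real k + u \<in> {0..15}"
      by simp
    from near[OF this] show "dist (F (real k + u)) (x + \<eta> *\<^sub>R ((1 - u) *\<^sub>R hash_vertex k + u *\<^sub>R hash_vertex (Suc k))) \<le> \<eta> / 5"
      unfolding * .
  qed (use assms(1) continuous_on_subset[OF assms(2), of "{0..7}"] in auto)
  show "traces_hash (\<lambda>s. F (8 + s)) x (5 * \<eta>)"
    unfolding traces_hash_def
  proof (intro conjI allI impI ballI)
    show "continuous_on {0..7} (\<lambda>s. F (8 + s))"
      by (rule continuous_on_compose2[OF assms(2)]) (auto intro!: continuous_intros)
    fix k :: nat and u :: real assume k: "k < 7" "u \<in> {0..1}"
    have "polyline hash_walk m (real (16 * j + 8 + k) + u)
        = (1 - u) *\<^sub>R hash_walk (16 * j + 8 + k) + u *\<^sub>R hash_walk (16 * j + 8 + Suc k)"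
      using polyline_segment[of "16 * j + 8 + k" m u hash_walk] k assms(3) by simp
    also have "\<dots> = (1 - u) *\<^sub>R 5 *\<^sub>R hash_vertex k + u *\<^sub>R 5 *\<^sub>R hash_vertex (Suc k)"
      using k(1) by (simp only: hash_walk_outer)
    also have "\<dots> = 5 *\<^sub>R ((1 - u) *\<^sub>R hash_vertex k + u *\<^sub>R hash_vertex (Suc k))"
      by (simp add: scaleR_add_right mult.commute)
    finally have *: "\<eta> *\<^sub>R polyline hash_walk m (16 * real j + (8 + (real k + u)))
        = (5 * \<eta>) *\<^sub>R ((1 - u) *\<^sub>R hash_vertex k + u *\<^sub>R hash_vertex (Suc k))"
      by (simp add: add.assoc mult.commute)
    have "real k \<le> 6" "0 \<le> u" "u \<le> 1"
      using k by auto
    then have "8 + (real k + u) \<in> {0..15}"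
      by simp
    from near[OF this]
    have "dist (F (8 + (real k + u))) (x + (5 * \<eta>) *\<^sub>R ((1 - u) *\<^sub>R hash_vertex k + u *\<^sub>R hash_vertex (Suc k))) \<le> \<eta> / 5"
      unfolding * .
    then show "dist (F (8 + (real k + u))) (x + (5 * \<eta>) *\<^sub>R ((1 - u) *\<^sub>R hash_vertex k + u *\<^sub>R hash_vertex (Suc k))) \<le> 5 * \<eta> / 5"
      using assms(1) by linarith
  qed (use assms(1) in auto)
qed

text \<open>Take the first grid cell starting at or after \<open>t\<close>, or, when
  \<open>t\<close> is too close to \<open>b\<close>, a cell ending at or before \<open>t\<close>. An
  interval of at least four cell lengths ensures that the latter does not start before
  \<open>a\<close>.\<close>

lemma grid_interval_near:
  fixes a b t N :: real
  assumes "0 \<le> a" "t \<in> {a..b}" "0 < N" "4 \<le> N * (b - a)"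
  obtains j :: nat where "a \<le> real j / N" "(real j + 1) / N \<le> b"
    "\<And>s. s \<in> {real j / N..(real j + 1) / N} \<Longrightarrow> \<bar>s - t\<bar> \<le> 2 / N"
proof -
  have Nt: "N * a \<le> N * t" "N * t \<le> N * b" "0 \<le> N * a" "N * a + 4 \<le> N * b"
    using assms by (auto simp: algebra_simps)
  have "\<exists>j::nat. N * a \<le> real j \<and> real j + 1 \<le> N * b \<and> N * t - 2 \<le> real j \<and> real j + 1 \<le> N * t + 2"
  proof (cases "N * t \<le> N * b - 2")
    case True
    define i where "i = \<lceil>N * t\<rceil>"
    have i: "N * t \<le> real_of_int i" "real_of_int i \<le> N * t + 1"
      unfolding i_def by linarith+
    then have "0 \<le> real_of_int i"
      using Nt True by linarith
    then have "real (nat i) = real_of_int i"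
      by simp
    then show ?thesis
      using Nt True i by (intro exI[of _ "nat i"] conjI) linarith+
  next
    case False
    define i where "i = \<lfloor>N * t\<rfloor> - 1"
    have i: "N * t - 2 \<le> real_of_int i" "real_of_int i \<le> N * t - 1"
      unfolding i_def by linarith+
    then have "0 \<le> real_of_int i"
      using Nt False by linarith
    then have "real (nat i) = real_of_int i"
      by simp
    then show ?thesis
      using Nt False i by (intro exI[of _ "nat i"] conjI) linarith+
  qed
  then obtain j :: nat where j: "N * a \<le> real j" "real j + 1 \<le> N * b" "N * t - 2 \<le> real j" "real j + 1 \<le> N * t + 2"
    by blast
  show thesis
  proof
    show "a \<le> real j / N"
      using j(1) assms(3) by (simp add: pos_le_divide_eq mult.commute)
    show "(real j + 1) / N \<le> b"
      using j(2) assms(3) by (simp add: pos_divide_le_eq mult.commute)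
    fix s assume "s \<in> {real j / N..(real j + 1) / N}"
    then have "real j \<le> s * N" "s * N \<le> real j + 1"
      using assms(3) by (simp_all add: pos_le_divide_eq pos_divide_le_eq)
    then have "(s - t) * N \<le> 2" "(t - s) * N \<le> 2"
      using j by (simp_all add: algebra_simps)
    then have "s - t \<le> 2 / N" "t - s \<le> 2 / N"
      using assms(3) by (simp_all only: pos_le_divide_eq)
    then show "\<bar>s - t\<bar> \<le> 2 / N"
      by (simp add: abs_le_iff)
  qed
qed

text \<open>The order of choices matters: \<open>g\<close> and \<open>\<delta>\<close> are fixed
  before \<open>f\<close>, \<open>C\<close>, \<open>p\<close> and \<open>q\<close>, so they serve
  all connected sets and all pairs of points at once.\<close>

lemma splits_dense:
  fixes f0 :: "real \<Rightarrow> real ^ 2"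
  assumes cont: "continuous_on {0..1} f0" and ab: "0 \<le> a" "a < b" "b \<le> 1" and "0 < \<epsilon>" "0 < M"
  obtains g \<delta> where "continuous_on {0..1} g" "\<And>t. t \<in> {0..1} \<Longrightarrow> dist (f0 t) (g t) \<le> \<epsilon>" "0 < \<delta>"
    "\<And>f C p q. \<lbrakk>continuous_on {0..1} f; \<And>t. t \<in> {0..1} \<Longrightarrow> dist (g t) (f t) \<le> \<delta>;
       connected C; p \<in> C; q \<in> C; p \<in> clear_of f a b M; q \<in> clear_of f a b M;
       separates (f ` {a..b}) p q\<rbrakk> \<Longrightarrow> splits f C a b"
proof -
  \<comment> \<open>Doubling \<open>M\<close> leaves room for replacing \<open>f\<close> by
    \<open>f0\<close>: points clear of \<open>f\<close> for \<open>M\<close> will be clear of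
    \<open>f0\<close> for \<open>2 * M\<close>.\<close>
  define K where "K = clear_of f0 a b (2 * M)"
  have "K = cball 0 (2 * M) \<inter> (\<Inter>t\<in>{a..b}. {p. 1 / (2 * M) \<le> dist p (f0 t)})"
    unfolding K_def clear_of_def by auto
  moreover have "closed (\<Inter>t\<in>{a..b}. {p. 1 / (2 * M) \<le> dist p (f0 t)})"
    by (intro closed_INT ballI closed_Collect_le continuous_intros)
  ultimately have "compact K"
    by (simp add: compact_Int_closed)
  have "compact (f0 ` {a..b})"
    using continuous_on_subset[OF cont, of "{a..b}"] ab by (intro compact_continuous_image) auto
  then have closed: "closed (f0 ` {a..b})"
    by (rule compact_imp_closed)
  have K0: "K \<subseteq> - f0 ` {a..b}"
  proof
    fix z assume "z \<in> K"
    then have "1 / (2 * M) \<le> dist z (f0 t)" if "t \<in> {a..b}" for t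
      using that unfolding K_def clear_of_def by blast
    moreover have "0 < 1 / (2 * M)" using \<open>0 < M\<close> by simp
    ultimately show "z \<in> - f0 ` {a..b}" by force
  qed
  obtain L where L: "compact L" "L \<subseteq> - f0 ` {a..b}"
    "\<And>p q. \<lbrakk>p \<in> K; q \<in> K; connected_component (- f0 ` {a..b}) p q\<rbrakk> \<Longrightarrow> connected_component L p q"
    using components_compactly_stable[OF open_Compl[OF closed] \<open>compact K\<close> K0] by blast
  obtain r where r: "0 < r" "\<And>z w. z \<in> L \<Longrightarrow> w \<in> f0 ` {a..b} \<Longrightarrow> r \<le> dist z w"
    using separate_compact_closed[OF L(1) closed] L(2) by blast
  \<comment> \<open>The curve \<open>f\<close> will be within 21 \<open>\<eta>\<close> of
    \<open>f0\<close>: 20 for the walk, the rest for \<open>\<delta>\<close>. The larger sign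
    separates points at distance 7 * 5 = 35 times \<open>\<eta>\<close>. The number 36 covers
    both.\<close>
  define \<eta> where "\<eta> = min r (min \<epsilon> (1 / (2 * M))) / 36"
  have \<eta>: "0 < \<eta>" "36 * \<eta> \<le> r" "36 * \<eta> \<le> \<epsilon>" "36 * \<eta> \<le> 1 / (2 * M)"
    unfolding \<eta>_def using r(1) assms(5,6) by auto
  \<comment> \<open>The error \<open>\<eta> / 5\<close> allowed to a trace is shared equally between
    the motion of \<open>f0\<close> while the signs are drawn and the distance from \<open>g\<close>
    to \<open>f\<close>.\<close>
  have "uniformly_continuous_on {0..1} f0"
    using cont by (intro compact_uniformly_continuous) auto
  moreover have "0 < \<eta> / 10" using \<eta>(1) by simp
  ultimately obtain \<tau> where "0 < \<tau>" and
    "\<And>t s. \<lbrakk>t \<in> {0..1}; s \<in> {0..1}; dist s t < \<tau>\<rbrakk> \<Longrightarrow> dist (f0 s) (f0 t) < \<eta> / 10"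
    by (rule uniformly_continuous_onE) blast
  then have \<tau>: "0 < \<tau>"
    "\<And>s t. \<lbrakk>s \<in> {0..1}; t \<in> {0..1}; dist s t < \<tau>\<rbrakk> \<Longrightarrow> dist (f0 s) (f0 t) < \<eta> / 10"
    by blast+
  \<comment> \<open>The first summand makes \<open>f0\<close> nearly constant on cells of length
    \<open>1 / N\<close> near a given time; the second provides enough cells inside
    \<open>[a,b]\<close>.\<close>
  obtain N :: nat where N: "2 / \<tau> + 4 / (b - a) < real N"
    using reals_Archimedean2 by blast
  have pos: "0 < 2 / \<tau>" "0 < 4 / (b - a)"
    using \<tau>(1) ab by auto
  have N0: "0 < real N" and N\<tau>: "2 / real N < \<tau>" and Nab: "4 \<le> real N * (b - a)"
  proof -
    show N0: "0 < real N" using N pos by linarith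
    have "2 / \<tau> < real N" "4 / (b - a) \<le> real N" using N pos by linarith+
    then show "2 / real N < \<tau>" "4 \<le> real N * (b - a)"
      using \<tau>(1) ab N0 by (simp_all add: field_simps)
  qed
  define m where "m = 16 * N"
  define P where "P = polyline hash_walk m"
  define g where "g t = f0 t + \<eta> *\<^sub>R P (16 * real N * t)" for t
  have Pnorm: "norm (P (16 * real N * t)) \<le> 20" if "t \<in> {0..1}" for t
    unfolding P_def by (rule norm_polyline_le[OF norm_hash_walk_le]) (use that N0 in \<open>auto simp: m_def\<close>)
  have fg: "dist (f0 t) (g t) \<le> 20 * \<eta>" if "t \<in> {0..1}" for t
    using mult_left_mono[OF Pnorm[OF that], of \<eta>] \<eta>(1) by (simp add: g_def dist_norm mult.commute)
  show thesis
  proof (rule that[of g "\<eta> / 10"])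
    show "continuous_on {0..1} g"
      unfolding g_def P_def
      by (intro continuous_intros cont continuous_on_compose2[OF continuous_on_polyline[of UNIV]]) auto
    show "dist (f0 t) (g t) \<le> \<epsilon>" if "t \<in> {0..1}" for t
      using fg[OF that] \<eta> by linarith
    show "0 < \<eta> / 10" using \<eta> by simp
    fix f C p q
    assume contf: "continuous_on {0..1} f" and near: "\<And>t. t \<in> {0..1} \<Longrightarrow> dist (g t) (f t) \<le> \<eta> / 10"
      and C: "connected C" "p \<in> C" "q \<in> C" and pq: "p \<in> clear_of f a b M" "q \<in> clear_of f a b M"
      and sep: "separates (f ` {a..b}) p q"
    have ff0: "dist (f0 t) (f t) < 21 * \<eta>" if "t \<in> {a..b}" for t
      using fg[of t] near[of t] dist_triangle[of "f0 t" "f t" "g t"] that ab \<eta>(1) by auto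
    have inK: "z \<in> K" if "z \<in> clear_of f a b M" for z
      unfolding K_def clear_of_def
    proof (intro CollectI conjI ballI)
      show "norm z \<le> 2 * M"
        using that \<open>0 < M\<close> unfolding clear_of_def by auto
      fix t assume t: "t \<in> {a..b}"
      have "1 / M \<le> dist z (f t)"
        using that t unfolding clear_of_def by blast
      moreover have "1 / M = 1 / (2 * M) + 1 / (2 * M)" by simp
      ultimately show "1 / (2 * M) \<le> dist z (f0 t)"
        using ff0[OF t] \<eta> dist_triangle[of z "f t" "f0 t"] by linarith
    qed
    \<comment> \<open>Points of \<open>K\<close> that \<open>f0\<close> leaves connected are joined
      inside \<open>L\<close>. As \<open>f\<close> misses \<open>L\<close>, it cannot separate them
      either.\<close>
    have "L \<subseteq> - f ` {a..b}"
    proof (intro subsetI ComplI notI)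
      fix z assume z: "z \<in> L" "z \<in> f ` {a..b}"
      then obtain t where t: "t \<in> {a..b}" "z = f t" by blast
      have "r \<le> dist z (f0 t)" using r(2) z(1) t(1) by blast
      then show False using ff0[OF t(1)] \<eta> t(2) by (simp add: dist_commute)
    qed
    then have "\<not> connected_component L p q"
      using sep connected_component_of_subset unfolding separates_iff by blast
    then have "separates (f0 ` {a..b}) p q"
      using L(3) inK pq K0 unfolding separates_iff by blast
    then have "C \<inter> f0 ` {a..b} \<noteq> {}"
      using separates_meets_connected C by blast
    then obtain t where t: "t \<in> {a..b}" "f0 t \<in> C" by blast
    \<comment> \<open>The curve \<open>f\<close> need not pass through \<open>x\<close>; what counts
      is that \<open>x\<close> lies in \<open>C\<close> and is the centre of both signs.\<close>
    define x where "x = f0 t"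
    obtain j :: nat where j: "a \<le> real j / N" "(real j + 1) / N \<le> b"
      "\<And>s. s \<in> {real j / N..(real j + 1) / N} \<Longrightarrow> \<bar>s - t\<bar> \<le> 2 / N"
      using grid_interval_near[OF ab(1) t(1) N0 Nab] by blast
    \<comment> \<open>This time change satisfies \<open>16 * N * T s = 16 * j + s\<close>, so it
      follows period \<open>j\<close> of the walk. It sends integers to rationals, which makes the
      two subintervals admissible.\<close>
    define T where "T s = s / (16 * real N) + real j / real N" for s
    have T: "T s \<in> {real j / N..(real j + 1) / N}" if "s \<in> {0..15}" for s
      using that N0 unfolding T_def by (simp add: field_simps)
    have Tab: "T s \<in> {a..b}" if "s \<in> {0..15}" for s
      using T[OF that] j(1,2) by auto
    have Tx: "dist (f0 (T s)) x < \<eta> / 10" if "s \<in> {0..15}" for s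
      unfolding x_def using j(3)[OF T[OF that]] Tab[OF that] t(1) ab N\<tau>
      by (intro \<tau>(2)) (auto simp: dist_real_def)
    define F where "F = (\<lambda>s. f (T s))"
    have contF: "continuous_on {0..15} F"
      unfolding F_def by (rule continuous_on_compose2[OF contf])
        (use Tab ab N0 in \<open>force simp: T_def intro!: continuous_intros\<close>)+
    have Fnear: "dist (F s) (x + \<eta> *\<^sub>R polyline hash_walk m (16 * real j + s)) \<le> \<eta> / 5"
      if "s \<in> {0..15}" for s
    proof -
      have "16 * real N * T s = 16 * real j + s"
        using N0 by (simp add: T_def field_simps)
      then have "g (T s) = f0 (T s) + \<eta> *\<^sub>R polyline hash_walk m (16 * real j + s)"
        by (simp add: g_def P_def)
      then have "dist (g (T s)) (x + \<eta> *\<^sub>R polyline hash_walk m (16 * real j + s)) < \<eta> / 10"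
        using Tx[OF that] by simp
      moreover have "dist (g (T s)) (F s) \<le> \<eta> / 10"
        unfolding F_def using near Tab[OF that] ab by auto
      ultimately show ?thesis
        using dist_triangle3[of "F s" "x + \<eta> *\<^sub>R polyline hash_walk m (16 * real j + s)" "g (T s)"]
        by linarith
    qed
    have "(real j + 1) / N \<le> 1"
      using j(2) ab(3) by linarith
    then have "real j + 1 \<le> real N"
      using N0 by (simp add: field_simps)
    then have jm: "16 * j + 16 \<le> m"
      unfolding m_def by linarith
    note hash = near_hash_walk_traces_hash[OF \<eta>(1) contF jm Fnear]
    have "1 / (2 * M) \<le> dist x p"
      using inK[OF pq(1)] t(1) unfolding K_def clear_of_def x_def by (auto simp: dist_commute)
    then have sep': "separates (F ` {0..7}) x p" "separates ((\<lambda>s. F (8 + s)) ` {0..7}) x p"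
      using \<eta> by (intro traces_hash_separates[OF hash(1)] traces_hash_separates[OF hash(2)]; linarith)+
    have im: "F ` {0..7} = f ` {T 0..T 7}" "(\<lambda>s. F (8 + s)) ` {0..7} = f ` {T 8..T 15}"
    proof -
      have "T ` {u..v} = {T u..T v}" if "u \<le> v" for u v
        unfolding T_def using N0 that by (subst image_affinity_atLeastAtMost_div) auto
      then have "T ` {0..7} = {T 0..T 7}" "T ` {8..15} = {T 8..T 15}"
        by simp_all
      moreover have "F ` {0..7} = f ` (T ` {0..7})"
        by (simp only: F_def image_image)
      moreover have "(\<lambda>s. F (8 + s)) ` {0..7} = f ` (T ` ((\<lambda>s. 8 + s) ` {0..7}))"
        by (simp only: F_def image_image)
      moreover have "(\<lambda>s. 8 + s) ` {0..7} = {8..15::real}"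
        by simp
      ultimately show "F ` {0..7} = f ` {T 0..T 7}" "(\<lambda>s. F (8 + s)) ` {0..7} = f ` {T 8..T 15}"
        by simp_all
    qed
    have rat: "T 0 \<in> \<rat>" "T 7 \<in> \<rat>" "T 8 \<in> \<rat>" "T 15 \<in> \<rat>"
      unfolding T_def by simp_all
    have less: "T 0 < T 7" "T 8 < T 15"
      unfolding T_def using N0 by (simp_all add: field_simps)
    have "a \<le> T 0" "T 7 \<le> b" "a \<le> T 8" "T 15 \<le> b"
      using Tab by auto
    moreover have "f ` {T 0..T 7} \<inter> f ` {T 8..T 15} = {}"
      using traces_hash_disjoint[OF hash] unfolding im .
    moreover have "cuts (f ` {T 0..T 7}) C" "cuts (f ` {T 8..T 15}) C"
      using sep' t(2) C(2) unfolding im cuts_def x_def by blast+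
    ultimately show "splits f C a b"
      unfolding splits_def using rat less by blast
  qed
qed

section \<open>The Cantor scheme\<close>

lemma real_lepoll_cut_set:
  fixes f :: "real \<Rightarrow> real ^ 2"
  assumes cont: "continuous_on {0..1} f" and C: "compact C" "connected C" and cuts: "cuts (f ` {0..1}) C"
    and step: "\<And>a b. \<lbrakk>a \<in> \<rat>; b \<in> \<rat>; 0 \<le> a; a < b; b \<le> 1; cuts (f ` {a..b}) C\<rbrakk> \<Longrightarrow> splits f C a b"
  shows "(UNIV :: real set) \<lesssim> C \<inter> f ` {0..1}"
proof -
  define ival where "ival I = {fst I..snd I}" for I :: "real \<times> real"
  define good where "good I \<longleftrightarrow> fst I \<in> \<rat> \<and> snd I \<in> \<rat> \<and> 0 \<le> fst I \<and> fst I < snd I \<and> snd I \<le> 1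
    \<and> cuts (f ` ival I) C" for I
  \<comment> \<open>The choice is made total by claiming nothing about intervals that are not
    good.\<close>
  have "\<exists>J :: bool \<Rightarrow> real \<times> real. good I \<longrightarrow> (\<forall>i. good (J i) \<and> ival (J i) \<subseteq> ival I)
      \<and> f ` ival (J True) \<inter> f ` ival (J False) = {}" for I
  proof (cases "good I")
    case True
    then have "splits f C (fst I) (snd I)"
      unfolding good_def ival_def by (intro step) auto
    then obtain c d c' d' where J: "c \<in> \<rat>" "d \<in> \<rat>" "c' \<in> \<rat>" "d' \<in> \<rat>" "fst I \<le> c" "c < d" "d \<le> snd I"
      "fst I \<le> c'" "c' < d'" "d' \<le> snd I" "f ` {c..d} \<inter> f ` {c'..d'} = {}"
      "cuts (f ` {c..d}) C" "cuts (f ` {c'..d'}) C"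
      unfolding splits_def by blast
    show ?thesis
      by (rule exI[of _ "\<lambda>i. if i then (c, d) else (c', d')"])
        (use True J in \<open>auto simp: good_def ival_def\<close>)
  qed auto
  then obtain J :: "real \<times> real \<Rightarrow> bool \<Rightarrow> real \<times> real" where
    J: "\<And>I i. good I \<Longrightarrow> good (J I i) \<and> ival (J I i) \<subseteq> ival I"
      "\<And>I. good I \<Longrightarrow> f ` ival (J I True) \<inter> f ` ival (J I False) = {}"
    by metis
  \<comment> \<open>A set of naturals encodes an infinite branch of the binary tree: membership of
    \<open>n\<close> selects the subinterval at level \<open>n\<close>.\<close>
  define V where "V \<sigma> = rec_nat (0, 1) (\<lambda>n I. J I (n \<in> \<sigma>))" for \<sigma> :: "nat set"
  have V0: "V \<sigma> 0 = (0, 1)" and VS: "V \<sigma> (Suc n) = J (V \<sigma> n) (n \<in> \<sigma>)" for \<sigma> n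
    unfolding V_def by simp_all
  have good: "good (V \<sigma> n)" for \<sigma> n
  proof (induction n)
    case 0
    show ?case using cuts by (simp add: V0 good_def ival_def)
  qed (simp add: VS J(1))
  define A where "A \<sigma> n = C \<inter> f ` ival (V \<sigma> n)" for \<sigma> n
  have "\<exists>z. \<forall>n. z \<in> A \<sigma> n" for \<sigma>
  proof -
    have "compact (A \<sigma> n)" for n
    proof -
      have *: "compact (f ` ival (V \<sigma> n))"
        using good[of \<sigma> n] continuous_on_subset[OF cont, of "ival (V \<sigma> n)"]
        unfolding good_def ival_def by (intro compact_continuous_image) auto
      show ?thesis unfolding A_def using C(1) * by (rule compact_Int)
    qed
    moreover have "A \<sigma> n \<noteq> {}" for n
    proof -
      obtain p q where "p \<in> C" "q \<in> C" "separates (f ` ival (V \<sigma> n)) p q"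
        using good[of \<sigma> n] unfolding good_def cuts_def by blast
      then show ?thesis
        unfolding A_def using separates_meets_connected C(2) by blast
    qed
    moreover have "A \<sigma> (Suc n) \<subseteq> A \<sigma> n" for n
      unfolding A_def VS using J(1)[OF good] by blast
    then have "A \<sigma> n \<subseteq> A \<sigma> m" if "m \<le> n" for m n
      using that by (rule lift_Suc_antimono_le)
    ultimately have "\<Inter> (range (A \<sigma>)) \<noteq> {}"
      by (rule compact_nest)
    then show ?thesis by blast
  qed
  then obtain z where z: "\<And>\<sigma> n. z \<sigma> \<in> A \<sigma> n"
    by metis
  have "inj z"
  proof (rule injI, rule ccontr)
    fix \<sigma> \<tau> assume eq: "z \<sigma> = z \<tau>" "\<sigma> \<noteq> \<tau>"
    \<comment> \<open>At the first difference both branches still have the same interval, and they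
      proceed to the two subintervals with disjoint images.\<close>
    define n where "n = (LEAST n. (n \<in> \<sigma>) \<noteq> (n \<in> \<tau>))"
    have "\<exists>n. (n \<in> \<sigma>) \<noteq> (n \<in> \<tau>)" using eq(2) by blast
    then have n: "(n \<in> \<sigma>) \<noteq> (n \<in> \<tau>)"
      unfolding n_def by (rule LeastI_ex)
    have agree: "(k \<in> \<sigma>) = (k \<in> \<tau>)" if "k < n" for k
      using not_less_Least[OF that[unfolded n_def]] by simp
    have "k \<le> n \<Longrightarrow> V \<sigma> k = V \<tau> k" for k
    proof (induction k)
      case (Suc k)
      then show ?case using agree[of k] by (simp add: VS)
    qed (simp add: V0)
    from this[OF order_refl]
    have "A \<sigma> (Suc n) \<inter> A \<tau> (Suc n) = {}"
      using n J(2)[OF good[of \<tau> n]] unfolding A_def VS by (cases "n \<in> \<sigma>") auto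
    then show False using z[of \<sigma> "Suc n"] z[of \<tau> "Suc n"] eq(1) by auto
  qed
  moreover have "range z \<subseteq> C \<inter> f ` {0..1}"
    using z[of _ 0] by (auto simp: A_def V0 ival_def)
  ultimately have "(UNIV :: nat set set) \<lesssim> C \<inter> f ` {0..1}"
    unfolding lepoll_def by blast
  then show ?thesis
    using lepoll_trans1 eqpoll_sym nat_sets_eqpoll_reals by blast
qed

section \<open>Genericity\<close>

lemma exists_clear_of:
  assumes "continuous_on {a..b} f" "p \<notin> f ` {a..b}" "q \<notin> f ` {a..b}"
  obtains n :: nat where "p \<in> clear_of f a b (real (Suc n))" "q \<in> clear_of f a b (real (Suc n))"
proof -
  have cl: "closed (f ` {a..b})"
    using assms(1) by (intro compact_imp_closed compact_continuous_image) auto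
  obtain d where d: "0 < d" "\<And>y. y \<in> f ` {a..b} \<Longrightarrow> d \<le> dist p y"
    using separate_point_closed[OF cl assms(2)] by blast
  obtain e where e: "0 < e" "\<And>y. y \<in> f ` {a..b} \<Longrightarrow> e \<le> dist q y"
    using separate_point_closed[OF cl assms(3)] by blast
  obtain n :: nat where n: "norm p + norm q + 1 / d + 1 / e < real n"
    using reals_Archimedean2 by blast
  have pos: "0 < 1 / d" "0 < 1 / e" using d(1) e(1) by auto
  have "norm p \<le> Suc n" "norm q \<le> Suc n" "1 / d \<le> Suc n" "1 / e \<le> Suc n"
    using n pos norm_ge_zero[of p] norm_ge_zero[of q] unfolding of_nat_Suc by linarith+
  moreover from this have "1 / real (Suc n) \<le> d" "1 / real (Suc n) \<le> e"
    using d(1) e(1) by (simp_all add: field_simps)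
  ultimately show thesis
    using d(2) e(2) by (intro that[of n]) (force simp: clear_of_def)+
qed

text \<open>A ball inside the closure of \<open>S\<close> would contain some \<open>g\<close> with a
  whole ball around it free of \<open>S\<close>. Pointwise distances in the hypothesis hide the
  extensional representatives.\<close>

lemma nowhere_dense_in_C2I:
  assumes "S \<subseteq> mspace C2_space"
    and dense: "\<And>f0 \<epsilon>. \<lbrakk>continuous_on {0..1} f0; 0 < \<epsilon>\<rbrakk> \<Longrightarrow>
      \<exists>g \<delta>. continuous_on {0..1} g \<and> (\<forall>t\<in>{0..1}. dist (f0 t) (g t) \<le> \<epsilon>) \<and> 0 < \<delta> \<and>
        (\<forall>f\<in>S. \<exists>t\<in>{0..1}. \<delta> < dist (g t) (f t))"
  shows "nowhere_dense_in (mtopology_of C2_space) S"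
proof -
  interpret Metric_space "mspace C2_space" "mdist C2_space"
    by (rule Metric_space_mspace_mdist)
  have "mtopology interior_of (mtopology closure_of S) = {}"
  proof (rule ccontr)
    assume "mtopology interior_of (mtopology closure_of S) \<noteq> {}"
    then obtain f0 \<epsilon> where f0: "f0 \<in> mspace C2_space" "0 < \<epsilon>" "mball f0 \<epsilon> \<subseteq> mtopology closure_of S"
      by (auto simp: metric_interior_of)
    obtain g \<delta> where g: "continuous_on {0..1} g" "\<And>t. t \<in> {0..1} \<Longrightarrow> dist (f0 t) (g t) \<le> \<epsilon> / 2" "0 < \<delta>"
      "\<And>f. f \<in> S \<Longrightarrow> \<exists>t\<in>{0..1}. \<delta> < dist (g t) (f t)"
      \<comment> \<open>Pointwise bounds survive the supremum only as weak inequalities, so half the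
        radius is used to land in the open ball.\<close>
      using dense[of f0 "\<epsilon> / 2"] f0 mem_C2_space_iff[of f0] by auto
    define g' where "g' = restrict g {0..1}"
    have g'eq: "g' t = g t" if "t \<in> {0..1}" for t
      using that by (simp add: g'_def)
    have g': "g' \<in> mspace C2_space"
      unfolding mem_C2_space_iff g'_def using g(1) by (auto cong: continuous_on_cong_simp)
    have "dist (f0 t) (g' t) \<le> \<epsilon> / 2" if "t \<in> {0..1}" for t
      using g(2)[OF that] g'eq[OF that] by simp
    then have "mdist C2_space f0 g' \<le> \<epsilon> / 2"
      unfolding mdist_C2_space[OF f0(1) g'] by (intro cSUP_least) simp
    then have "g' \<in> mtopology closure_of S"
      using f0 g' by (auto intro!: subsetD[OF f0(3)])
    then obtain f where f: "f \<in> S" "f \<in> mball g' \<delta>"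
      using g(3) by (auto simp: metric_closure_of)
    obtain t where t: "t \<in> {0..1}" "\<delta> < dist (g t) (f t)"
      using g(4) f(1) by blast
    have fC: "f \<in> mspace C2_space" using f(1) assms(1) by blast
    have "bdd_above ((\<lambda>x. dist (g' x) (f x)) ` {0..1})"
      using fC g' unfolding mem_C2_space_iff
      by (intro bounded_imp_bdd_above compact_imp_bounded compact_continuous_image continuous_intros) auto
    then have "dist (g' t) (f t) \<le> mdist C2_space g' f"
      unfolding mdist_C2_space[OF g' fC] using t(1) by (intro cSUP_upper) auto
    then show False using t f(2) by (simp add: g'eq)
  qed
  then show ?thesis
    using assms(1) unfolding nowhere_dense_in_def mtopology_of_def by simp
qed

lemma comeager_in_if_countable_nowhere_dense:
  fixes B :: "'i::countable \<Rightarrow> 'a set"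
  assumes "\<And>i. nowhere_dense_in X (B i)" "topspace X - S \<subseteq> (\<Union>i. B i)" "S \<subseteq> topspace X"
  shows "comeager_in X S"
proof -
  have sub: "nowhere_dense_in X U" if "nowhere_dense_in X T" "U \<subseteq> T" for T U
    using that closure_of_mono[of U T X] interior_of_mono[of "X closure_of U" "X closure_of T" X]
    unfolding nowhere_dense_in_def by blast
  \<comment> \<open>The intersection turns the covering into the exact union that
    \<open>meager_in\<close> demands.\<close>
  define N where "N n = (topspace X - S) \<inter> B (from_nat n)" for n
  have "topspace X - S = (\<Union>n. N n)"
    unfolding N_def using assms(2) by (auto, metis UN_E from_nat_to_nat subsetD Diff_iff)
  moreover have "nowhere_dense_in X (N n)" for n
    unfolding N_def by (rule sub[OF assms(1)]) auto
  ultimately show ?thesis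
    unfolding comeager_in_def meager_in_def using assms(3) by blast
qed

text \<open>These are the exceptional sets. Only the size bound and the rational interval are
  indexed; the uncountably many \<open>C\<close>, \<open>p\<close>, \<open>q\<close> are quantified
  inside, so countably many sets suffice.\<close>

definition unsplit :: "nat \<times> rat \<times> rat \<Rightarrow> (real \<Rightarrow> real ^ 2) set" where
  "unsplit = (\<lambda>(n, \<alpha>, \<beta>). let a = real_of_rat \<alpha>; b = real_of_rat \<beta>; M = real (Suc n) in
     {f \<in> mspace C2_space. 0 \<le> a \<and> a < b \<and> b \<le> 1 \<and>
        (\<exists>C p q. connected C \<and> p \<in> C \<and> q \<in> C \<and> p \<in> clear_of f a b M \<and> q \<in> clear_of f a b M \<and>
           separates (f ` {a..b}) p q \<and> \<not> splits f C a b)})"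

lemma nowhere_dense_unsplit: "nowhere_dense_in (mtopology_of C2_space) (unsplit i)"
proof (rule nowhere_dense_in_C2I)
  obtain n \<alpha> \<beta> where i: "i = (n, \<alpha>, \<beta>)" by (cases i)
  define a b M where "a = real_of_rat \<alpha>" "b = real_of_rat \<beta>" "M = real (Suc n)"
  note ab = this
  have eq: "unsplit i = {f \<in> mspace C2_space. 0 \<le> a \<and> a < b \<and> b \<le> 1 \<and>
        (\<exists>C p q. connected C \<and> p \<in> C \<and> q \<in> C \<and> p \<in> clear_of f a b M \<and> q \<in> clear_of f a b M \<and>
           separates (f ` {a..b}) p q \<and> \<not> splits f C a b)}"
    unfolding unsplit_def i ab Let_def by simp
  then show "unsplit i \<subseteq> mspace C2_space" by blast
  fix f0 :: "real \<Rightarrow> real ^ 2" and \<epsilon> :: real assume f0: "continuous_on {0..1} f0" "0 < \<epsilon>"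
  show "\<exists>g \<delta>. continuous_on {0..1} g \<and> (\<forall>t\<in>{0..1}. dist (f0 t) (g t) \<le> \<epsilon>) \<and> 0 < \<delta> \<and>
        (\<forall>f\<in>unsplit i. \<exists>t\<in>{0..1}. \<delta> < dist (g t) (f t))"
  proof (cases "0 \<le> a \<and> a < b \<and> b \<le> 1")
    case True
    have "0 < M" by (simp add: ab)
    then obtain g \<delta> where g: "continuous_on {0..1} g" "\<And>t. t \<in> {0..1} \<Longrightarrow> dist (f0 t) (g t) \<le> \<epsilon>" "0 < \<delta>"
      "\<And>f C p q. \<lbrakk>continuous_on {0..1} f; \<And>t. t \<in> {0..1} \<Longrightarrow> dist (g t) (f t) \<le> \<delta>;
       connected C; p \<in> C; q \<in> C; p \<in> clear_of f a b M; q \<in> clear_of f a b M;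
       separates (f ` {a..b}) p q\<rbrakk> \<Longrightarrow> splits f C a b"
      using splits_dense[OF f0(1) _ _ _ f0(2), of a b M] True by metis
    have "\<exists>t\<in>{0..1}. \<delta> < dist (g t) (f t)" if f: "f \<in> unsplit i" for f
    proof (rule ccontr)
      assume "\<not> (\<exists>t\<in>{0..1}. \<delta> < dist (g t) (f t))"
      then have "\<And>t. t \<in> {0..1} \<Longrightarrow> dist (g t) (f t) \<le> \<delta>" by force
      then show False using f g(4)[of f] unfolding eq mem_C2_space_iff by blast
    qed
    then show ?thesis using g(1-3) by blast
  next
    case False
    then have "unsplit i = {}" unfolding eq by blast
    then show ?thesis using f0 by (intro exI[of _ f0] exI[of _ 1]) auto
  qed
qed

lemma splits_if_not_unsplit:
  assumes f: "f \<in> mspace C2_space" "\<And>i. f \<notin> unsplit i"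
    and ab: "a \<in> \<rat>" "b \<in> \<rat>" "0 \<le> a" "a < b" "b \<le> 1" and C: "connected C" "cuts (f ` {a..b}) C"
  shows "splits f C a b"
proof -
  obtain \<alpha> \<beta> where rat: "a = real_of_rat \<alpha>" "b = real_of_rat \<beta>"
    using ab(1,2) by (auto elim!: Rats_cases)
  obtain p q where pq: "p \<in> C" "q \<in> C" "separates (f ` {a..b}) p q"
    using C(2) unfolding cuts_def by blast
  have "continuous_on {a..b} f"
    using f(1) ab continuous_on_subset[of "{0..1}" f "{a..b}"] unfolding mem_C2_space_iff by auto
  then obtain n where "p \<in> clear_of f a b (real (Suc n))" "q \<in> clear_of f a b (real (Suc n))"
    using exists_clear_of[of a b f p q] pq(3) unfolding separates_iff by blast
  then show ?thesis
    using f(2)[of "(n, \<alpha>, \<beta>)"] f(1) ab C(1) pq unfolding unsplit_def Let_def rat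
    by (simp del: of_nat_Suc)
qed

theorem theorem5p17:
  shows "generic_C2 (\<lambda>f. \<forall>p q :: real ^ 2.
           p \<notin> Ran f \<longrightarrow> q \<notin> Ran f \<longrightarrow> separates (Ran f) p q \<longrightarrow>
           (\<forall>C :: (real ^ 2) set. continuum C \<longrightarrow> p \<in> C \<longrightarrow> q \<in> C \<longrightarrow>
              C \<inter> Ran f \<approx> (UNIV :: real set)))"
  unfolding generic_C2_def
proof (rule comeager_in_if_countable_nowhere_dense[OF nowhere_dense_unsplit])
  let ?P = "\<lambda>f. \<forall>p q :: real ^ 2.
           p \<notin> Ran f \<longrightarrow> q \<notin> Ran f \<longrightarrow> separates (Ran f) p q \<longrightarrow>
           (\<forall>C :: (real ^ 2) set. continuum C \<longrightarrow> p \<in> C \<longrightarrow> q \<in> C \<longrightarrow>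
              C \<inter> Ran f \<approx> (UNIV :: real set))"
  have "?P f" if f: "f \<in> mspace C2_space" "\<And>i. f \<notin> unsplit i" for f
  proof (intro allI impI)
    fix p q C assume *: "separates (Ran f) p q" "continuum C" "p \<in> C" "q \<in> C"
    have "cuts (f ` {0..1}) C"
      using * unfolding cuts_def Ran_def by blast
    then have "(UNIV :: real set) \<lesssim> C \<inter> f ` {0..1}"
      using f *(2) unfolding continuum_def
      by (intro real_lepoll_cut_set splits_if_not_unsplit) (auto simp: mem_C2_space_iff)
    \<comment> \<open>The Cantor scheme gives the lower bound, second countability of the plane the
      upper one, and Schroeder-Bernstein combines them.\<close>
    then show "C \<inter> Ran f \<approx> (UNIV :: real set)"
      unfolding Ran_def by (intro lepoll_antisym second_countable_lepoll_real)
  qed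
  then show "topspace (mtopology_of C2_space) - {f \<in> mspace C2_space. ?P f} \<subseteq> (\<Union>i. unsplit i)"
    by auto
qed auto

end
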